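(* Let $(q_{n})_{n=1}^{\infty}$ be a strictly increasing sequence of positive real numbers satisfying $\lim_{n\to\infty}(q_{n+1}-q_{n})= \infty$, and let $(r_{n})_{n=1}^{\infty}$ be an arbitrary sequence of real numbers. Let $$E(q_{n},r_{n}):=\Big\{\alpha\in(1,\infty): \lim_{n\to\infty}\|\alpha^{q_{n}}-r_{n}\|= 0\Big\}.$$ Then $E(q_{n},r_{n})$ is dense in $(1,\infty)$ and has Hausdorff dimension $1$.
   Context: For a real number $x$, $\|x\|$ denotes the distance from $x$ to the nearest integer. *)

theory Defs
  imports "HOL-Analysis.Analysis"
begin

definition dist_nearest_int :: "real \<Rightarrow> real" where
  "dist_nearest_int x = infdist x \<int>"

(* The s-th power of the diameter, with the conventions 0^0 = 1 for nonempty sets and 0 for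
   the empty set; note that 0 powr 0 = 0, so the case s = 0 is treated separately. *)
definition diam_pow :: "real \<Rightarrow> 'a::metric_space set \<Rightarrow> real" where
  "diam_pow s U = (if U = {} then 0 else if s = 0 then 1 else diameter U powr s)"

(* Boundedness is required explicitly because the library's diameter carries no
   information on unbounded sets. Finite covers are included, padded with empty sets. *)
definition delta_covers :: "real \<Rightarrow> 'a::metric_space set \<Rightarrow> (nat \<Rightarrow> 'a set) set" where
  "delta_covers \<delta> E =
     {U. E \<subseteq> (\<Union>i. U i) \<and> (\<forall>i. bounded (U i) \<and> diameter (U i) \<le> \<delta>)}"

definition hausdorff_premeasure :: "real \<Rightarrow> real \<Rightarrow> 'a::metric_space set \<Rightarrow> ennreal" where
  "hausdorff_premeasure s \<delta> E = (INF U \<in> delta_covers \<delta> E. \<Sum>i. ennreal (diam_pow s (U i)))"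

definition hausdorff_measure :: "real \<Rightarrow> 'a::metric_space set \<Rightarrow> ennreal" where
  "hausdorff_measure s E = (SUP \<delta> \<in> {0<..}. hausdorff_premeasure s \<delta> E)"

definition hausdorff_dim :: "'a::metric_space set \<Rightarrow> ennreal" where
  "hausdorff_dim E = Inf {ennreal s | s. 0 \<le> s \<and> hausdorff_measure s E = 0}"

definition E_set :: "(nat \<Rightarrow> real) \<Rightarrow> (nat \<Rightarrow> real) \<Rightarrow> real set" where
  "E_set q r =
     {\<alpha>. 1 < \<alpha> \<and> (\<lambda>n. dist_nearest_int (\<alpha> powr q n - r n)) \<longlonglongrightarrow> 0}"

end

theory Submission
  imports Defs "HOL-Real_Asymp.Real_Asymp"
begin

text \<open>
  For b > 1, consider the intervals of those \<alpha> \<ge> b for which \<alpha> powr q n lies in [a, a + \<eta> n] with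
  a - r n an integer, where \<eta> n is the inverse of the smaller of the two gaps of q next to n.
  They form a tree, because \<alpha> powr q (n + 1) sweeps many unit cells while \<alpha> runs through one
  interval of level n. Each child gets a weight proportional to the length of its cell, which keeps
  the weights under control however fast q grows. Since \<eta> decays only like the inverse of a gap
  while the lengths shrink exponentially in the gap, the weights satisfy an s-dimensional bound for
  every s < 1.

  Instead of building a measure, one walks down the tree. Given a cover with small s-sum, each
  interval carries a load, namely the sum of min 1 (C |U| powr s / |J| powr s) over the sets U of
  the cover that meet J. The weighted average of the loads of the children is at most the load of
  the parent, so some branch keeps its load below 1, and its limit point lies in no set of the
  cover. Taking an empty cover gives density. The upper bound comes from covering the half-line by
  intervals of lengths c / 1, c / 2, c / 3 and so on.
\<close>

section \<open>Covers, loads and the descent through a tree of intervals\<close>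

text \<open>
  The intervals [u k, v k] for k < K are children of [l, h] with weights w k. A set meeting at most
  two children is controlled by the factor 2 in the third line, a set meeting more of them by the
  last clause.
\<close>

definition well_spread ::
  "real \<Rightarrow> real \<Rightarrow> real \<Rightarrow> real \<Rightarrow> nat \<Rightarrow> (nat \<Rightarrow> real) \<Rightarrow> (nat \<Rightarrow> real) \<Rightarrow> (nat \<Rightarrow> real) \<Rightarrow> bool" where
  "well_spread s C l h K u v w \<longleftrightarrow> l < h \<and> sum w {..<K} = 1 \<and>
     (\<forall>k<K. l \<le> u k \<and> u k < v k \<and> v k \<le> h \<and> v k - u k \<le> (h - l) / 2 \<and> 0 < w k \<and>
        2 * w k * (h - l) powr s \<le> (v k - u k) powr s) \<and>
     (\<forall>i j. i + 2 \<le> j \<longrightarrow> j < K \<longrightarrow>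
        v i \<le> u j \<and> sum w {i..j} * (h - l) powr s \<le> C * (u j - v i) powr s)"

text \<open>The cap at 1 lets the load of a set be bounded by the total weight of the children it
  meets. The number \<open>e\<close> only has to dominate \<open>diameter U powr s\<close>, so it
  can be kept positive even when \<open>U\<close> is a point or empty.\<close>

definition cover_load :: "real \<Rightarrow> real \<Rightarrow> real set \<Rightarrow> real \<Rightarrow> real \<Rightarrow> real \<Rightarrow> real" where
  "cover_load s C U e l h = (if U \<inter> {l..h} = {} then 0 else min 1 (C * e / (h - l) powr s))"

lemma cover_load_nonneg: "0 \<le> C \<Longrightarrow> 0 \<le> e \<Longrightarrow> 0 \<le> cover_load s C U e l h"
  by (simp add: cover_load_def)

lemma cover_load_le: "0 \<le> C \<Longrightarrow> 0 \<le> e \<Longrightarrow> cover_load s C U e l h \<le> C * e / (h - l) powr s"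
  by (simp add: cover_load_def)

lemma summable_cover_load:
  assumes C: "0 \<le> C" and e: "\<And>i::nat. 0 \<le> e i" and sum_e: "summable e"
  shows "summable (\<lambda>i. cover_load s C (U i) (e i) l h)"
proof (rule summable_comparison_test')
  show "summable (\<lambda>i. C * e i / (h - l) powr s)"
    by (intro summable_divide summable_mult sum_e)
  show "norm (cover_load s C (U i) (e i) l h) \<le> C * e i / (h - l) powr s" for i
    using cover_load_nonneg[OF C e] cover_load_le[OF C e] by simp
qed

text \<open>The bound by 1 holds because the loads are capped and the weights sum to 1. For the
  other bound, let \<open>i\<close> and \<open>j\<close> be the first and last child met. If they
  are at least two apart, \<open>U\<close> spans the distance from \<open>v i\<close> to
  \<open>u j\<close>, and the last clause of \<open>well_spread\<close> bounds the weight of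
  everything between. Otherwise at most two children are met, and the factor 2 in
  \<open>well_spread\<close> makes each contribute at most half of the bound.\<close>

lemma cover_load_average_le:
  assumes spread: "well_spread s C l h K u v w"
    and C: "0 \<le> C" and s: "0 < s" and U: "bounded U" and e: "diameter U powr s \<le> e"
  shows "(\<Sum>k<K. w k * cover_load s C U e (u k) (v k)) \<le> cover_load s C U e l h"
proof -
  have lh: "l < h" and sum1: "sum w {..<K} = 1"
    and ch: "\<And>k. k < K \<Longrightarrow> l \<le> u k \<and> u k < v k \<and> v k \<le> h \<and> 0 < w k \<and>
        2 * w k * (h - l) powr s \<le> (v k - u k) powr s"
    and far: "\<And>i j. i + 2 \<le> j \<Longrightarrow> j < K \<Longrightarrow>
        v i \<le> u j \<and> sum w {i..j} * (h - l) powr s \<le> C * (u j - v i) powr s"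
    using spread unfolding well_spread_def by blast+
  have e0: "0 \<le> e" using e powr_ge_zero order_trans by blast
  define I where "I = {k. k < K \<and> U \<inter> {u k..v k} \<noteq> {}}"
  have finI: "finite I" and IK: "I \<subseteq> {..<K}" by (auto simp: I_def)
  have eqI: "(\<Sum>k<K. w k * cover_load s C U e (u k) (v k))
      = (\<Sum>k\<in>I. w k * cover_load s C U e (u k) (v k))"
    by (rule sum.mono_neutral_right) (auto simp: I_def cover_load_def)
  have le_w: "(\<Sum>k\<in>I. w k * cover_load s C U e (u k) (v k)) \<le> sum w I"
  proof (rule sum_mono)
    fix k assume "k \<in> I"
    then have "0 < w k" using ch by (auto simp: I_def)
    then show "w k * cover_load s C U e (u k) (v k) \<le> w k"
      by (simp add: cover_load_def)
  qed
  have wI: "sum w I \<le> 1"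
    unfolding sum1[symmetric] using IK ch by (intro sum_mono2) (auto intro: less_imp_le)
  show ?thesis
  proof (cases "I = {}")
    case True
    then show ?thesis unfolding eqI by (simp add: cover_load_nonneg C e0)
  next
    case False
    then obtain k where "k < K" "U \<inter> {u k..v k} \<noteq> {}" by (auto simp: I_def)
    then have "U \<inter> {l..h} \<noteq> {}" using ch[of k] by fastforce
    then have load: "cover_load s C U e l h = min 1 (C * e / (h - l) powr s)"
      by (simp add: cover_load_def)
    have pos: "0 < (h - l) powr s" using lh by simp
    have "(\<Sum>k\<in>I. w k * cover_load s C U e (u k) (v k)) \<le> C * e / (h - l) powr s"
    proof (cases "Min I + 2 \<le> Max I")
      case True
      define i j where "i = Min I" and "j = Max I"
      have ij: "i + 2 \<le> j" using True by (simp add: i_def j_def)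
      have "i \<in> I" "j \<in> I" using finI False by (simp_all add: i_def j_def)
      then obtain x y where x: "x \<in> U" "x \<le> v i" and y: "y \<in> U" "u j \<le> y" and jK: "j < K"
        by (auto simp: I_def)
      have vu: "v i \<le> u j" using far[OF ij jK] by blast
      have "u j - v i \<le> dist y x" using x y vu by (simp add: dist_real_def)
      also have "\<dots> \<le> diameter U" using U x y by (intro diameter_bounded_bound)
      finally have "(u j - v i) powr s \<le> diameter U powr s"
        using vu s by (intro powr_mono2) auto
      then have D: "C * (u j - v i) powr s \<le> C * e" using e C by (intro mult_left_mono) auto
      have sub: "I \<subseteq> {i..j}" using finI by (auto simp: i_def j_def)
      have "sum w I \<le> sum w {i..j}"
        using sub ch jK by (intro sum_mono2) (auto intro: less_imp_le)
      then have "sum w I * (h - l) powr s \<le> sum w {i..j} * (h - l) powr s"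
        using pos by simp
      also have "\<dots> \<le> C * e" using far[OF ij jK] D by linarith
      finally have "sum w I \<le> C * e / (h - l) powr s"
        using pos by (simp add: field_simps)
      then show ?thesis using le_w by linarith
    next
      case False
      have "I \<subseteq> {Min I..Min I + 1}"
      proof
        fix k assume k: "k \<in> I"
        have "Min I \<le> k" "k \<le> Max I" using finI k by auto
        then show "k \<in> {Min I..Min I + 1}" using False by auto
      qed
      then have "card I \<le> card {Min I..Min I + 1}" by (intro card_mono) auto
      then have card: "card I \<le> 2" by simp
      have "(\<Sum>k\<in>I. w k * cover_load s C U e (u k) (v k)) \<le> (\<Sum>k\<in>I. C * e / (2 * (h - l) powr s))"
      proof (rule sum_mono)
        fix k assume "k \<in> I"
        then have k: "u k < v k" "0 < w k" "2 * w k * (h - l) powr s \<le> (v k - u k) powr s"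
          using ch by (auto simp: I_def)
        have vp: "0 < (v k - u k) powr s" using k by simp
        have "w k \<le> (v k - u k) powr s / (2 * (h - l) powr s)"
          using k(3) pos by (simp add: field_simps)
        then have "w k * (C * e / (v k - u k) powr s)
          \<le> (v k - u k) powr s / (2 * (h - l) powr s) * (C * e / (v k - u k) powr s)"
          using C e0 by (intro mult_right_mono) auto
        also have "\<dots> = C * e / (2 * (h - l) powr s)" using vp by (simp add: field_simps)
        finally have "w k * (C * e / (v k - u k) powr s) \<le> C * e / (2 * (h - l) powr s)" .
        moreover have "w k * cover_load s C U e (u k) (v k) \<le> w k * (C * e / (v k - u k) powr s)"
          using k(2) cover_load_le[OF C e0] by (intro mult_left_mono) auto
        ultimately show "w k * cover_load s C U e (u k) (v k) \<le> C * e / (2 * (h - l) powr s)"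
          by linarith
      qed
      also have "\<dots> = card I * (C * e / (2 * (h - l) powr s))" by simp
      also have "\<dots> \<le> 2 * (C * e / (2 * (h - l) powr s))"
        using card C e0 by (intro mult_right_mono) auto
      also have "\<dots> = C * e / (h - l) powr s" by simp
      finally show ?thesis .
    qed
    then show ?thesis unfolding eqI load using le_w wI by simp
  qed
qed

text \<open>If all children had total load at least 1, so would their weighted average; exchanging
  the two sums and averaging set by set bounds it by the load of the parent.\<close>

lemma well_spread_light_child:
  fixes U :: "nat \<Rightarrow> real set" and e :: "nat \<Rightarrow> real"
  assumes spread: "well_spread s C l h K u v w"
    and C: "0 \<le> C" and s: "0 < s" and U: "\<And>i. bounded (U i)"
    and e: "\<And>i. diameter (U i) powr s \<le> e i" and sum_e: "summable e"
    and light: "(\<Sum>i. cover_load s C (U i) (e i) l h) < 1"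
  shows "\<exists>k<K. (\<Sum>i. cover_load s C (U i) (e i) (u k) (v k)) < 1"
proof (rule ccontr)
  assume "\<not> ?thesis"
  then have heavy: "\<And>k. k < K \<Longrightarrow> 1 \<le> (\<Sum>i. cover_load s C (U i) (e i) (u k) (v k))"
    by (meson not_less)
  have e0: "0 \<le> e i" for i using e[of i] powr_ge_zero order_trans by blast
  have summ: "summable (\<lambda>i. cover_load s C (U i) (e i) x y)" for x y
    by (rule summable_cover_load[OF C e0 sum_e])
  have w: "0 < w k" if "k < K" for k using spread that by (auto simp: well_spread_def)
  have "1 = (\<Sum>k<K. w k * 1)" using spread by (simp add: well_spread_def)
  also have "\<dots> \<le> (\<Sum>k<K. w k * (\<Sum>i. cover_load s C (U i) (e i) (u k) (v k)))"
    using w heavy by (intro sum_mono mult_left_mono) (auto intro: less_imp_le)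
  also have "\<dots> = (\<Sum>k<K. (\<Sum>i. w k * cover_load s C (U i) (e i) (u k) (v k)))"
    by (simp add: suminf_mult summ)
  also have "\<dots> = (\<Sum>i. \<Sum>k<K. w k * cover_load s C (U i) (e i) (u k) (v k))"
    by (rule suminf_sum[symmetric]) (intro summable_mult summ)
  also have "\<dots> \<le> (\<Sum>i. cover_load s C (U i) (e i) l h)"
    by (intro suminf_le cover_load_average_le[OF spread C s U e] summable_sum summable_mult summ)
  finally show False using light by simp
qed

text \<open>The hypothesis \<open>small\<close> makes the total load of the root less than 1, and
  choosing light children forever gives nested intervals shrinking to a point. A set containing that
  point would alone have load 1 on a sufficiently short interval of the branch.\<close>

lemma well_spread_tree_avoids_cover:
  fixes U :: "nat \<Rightarrow> real set" and e :: "nat \<Rightarrow> real" and G :: "nat \<Rightarrow> real \<Rightarrow> real \<Rightarrow> bool"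
  assumes tree: "\<And>n l h. G n l h \<Longrightarrow>
      \<exists>K u v w. well_spread s C l h K u v w \<and> (\<forall>k<K. G (Suc n) (u k) (v k))"
    and root: "G n\<^sub>0 l\<^sub>0 h\<^sub>0"
    and C: "0 < C" and s: "0 < s" and U: "\<And>i. bounded (U i)"
    and e: "\<And>i. 0 < e i" "\<And>i. diameter (U i) powr s \<le> e i" and sum_e: "summable e"
    and small: "C * suminf e < (h\<^sub>0 - l\<^sub>0) powr s"
  shows "\<exists>x. (\<forall>i. x \<notin> U i) \<and> (\<forall>k. \<exists>l h. G (n\<^sub>0 + k) l h \<and> x \<in> {l..h} \<and> l\<^sub>0 \<le> l \<and> h \<le> h\<^sub>0)"
proof -
  define light where "light = (\<lambda>l h. (\<Sum>i. cover_load s C (U i) (e i) l h) < 1)"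
  have C0: "0 \<le> C" using C by simp
  have summ: "summable (\<lambda>i. cover_load s C (U i) (e i) x y)" for x y
    by (rule summable_cover_load[OF C0 less_imp_le[OF e(1)] sum_e])
  have lt: "l < h" if "G n l h" for n l h using tree[OF that] by (auto simp: well_spread_def)
  have step: "\<exists>l' h'. G (Suc n) l' h' \<and> light l' h' \<and> l \<le> l' \<and> h' \<le> h \<and> h' - l' \<le> (h - l) / 2"
    if node: "G n l h" "light l h" for n l h
  proof -
    obtain K u v w where *: "well_spread s C l h K u v w" "\<forall>k<K. G (Suc n) (u k) (v k)"
      using tree[OF node(1)] by blast
    obtain k where k: "k < K" "light (u k) (v k)"
      using well_spread_light_child[OF *(1) C0 s U e(2) sum_e] node(2) by (auto simp: light_def)
    then show ?thesis using * by (intro exI[of _ "u k"] exI[of _ "v k"]) (auto simp: well_spread_def)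
  qed
  have "light l\<^sub>0 h\<^sub>0"
  proof -
    have pos: "0 < (h\<^sub>0 - l\<^sub>0) powr s" using lt[OF root] by simp
    have "(\<Sum>i. cover_load s C (U i) (e i) l\<^sub>0 h\<^sub>0) \<le> (\<Sum>i. C * e i / (h\<^sub>0 - l\<^sub>0) powr s)"
      using cover_load_le[OF C0 less_imp_le[OF e(1)]]
      by (intro suminf_le summ summable_divide summable_mult sum_e) auto
    also have "\<dots> = C * suminf e / (h\<^sub>0 - l\<^sub>0) powr s"
      by (simp add: suminf_divide suminf_mult summable_mult sum_e)
    also have "\<dots> < 1" using small pos by simp
    finally show ?thesis by (simp add: light_def)
  qed
  define P where "P = (\<lambda>k (z::real\<times>real). G (n\<^sub>0 + k) (fst z) (snd z) \<and> light (fst z) (snd z) \<and>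
    l\<^sub>0 \<le> fst z \<and> snd z \<le> h\<^sub>0 \<and> snd z - fst z \<le> (h\<^sub>0 - l\<^sub>0) / 2 ^ k)"
  define Q where "Q = (\<lambda>(k::nat) (z::real\<times>real) z'. fst z \<le> fst z' \<and> snd z' \<le> snd z)"
  have "\<exists>f. \<forall>k. P k (f k) \<and> Q k (f k) (f (Suc k))"
  proof (rule dependent_nat_choice)
    show "\<exists>z. P 0 z"
      using root \<open>light l\<^sub>0 h\<^sub>0\<close> by (intro exI[of _ "(l\<^sub>0, h\<^sub>0)"]) (auto simp: P_def)
    fix z k assume "P k z"
    then have z: "G (n\<^sub>0 + k) (fst z) (snd z)" "light (fst z) (snd z)" "l\<^sub>0 \<le> fst z" "snd z \<le> h\<^sub>0"
      "snd z - fst z \<le> (h\<^sub>0 - l\<^sub>0) / 2 ^ k" by (auto simp: P_def)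
    obtain l' h' where c: "G (Suc (n\<^sub>0 + k)) l' h'" "light l' h'" "fst z \<le> l'" "h' \<le> snd z"
      "h' - l' \<le> (snd z - fst z) / 2" using step[OF z(1,2)] by blast
    have "h' - l' \<le> (h\<^sub>0 - l\<^sub>0) / 2 ^ k / 2" 
      by (rule order_trans[OF c(5)]) (rule divide_right_mono[OF z(5)], simp)
    then show "\<exists>z'. P (Suc k) z' \<and> Q k z z'"
      using c z by (intro exI[of _ "(l', h')"]) (auto simp: P_def Q_def)
  qed
  then obtain f where f: "\<And>k. P k (f k)" "\<And>k. Q k (f k) (f (Suc k))" by blast
  define L H where "L = (\<lambda>k. fst (f k))" and "H = (\<lambda>k. snd (f k))"
  have node: "G (n\<^sub>0 + k) (L k) (H k)" "light (L k) (H k)" "l\<^sub>0 \<le> L k" "H k \<le> h\<^sub>0"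
    "H k - L k \<le> (h\<^sub>0 - l\<^sub>0) / 2 ^ k" for k using f(1)[of k] by (auto simp: P_def L_def H_def)
  have LH: "L k < H k" for k using lt[OF node(1)] .
  have inc: "incseq L" and dec: "decseq H"
    using f(2) by (auto simp: Q_def L_def H_def intro: incseq_SucI decseq_SucI)
  define x where "x = (SUP k. L k)"
  have LH': "L i \<le> H j" for i j
  proof -
    have "L i \<le> L (max i j)" "H (max i j) \<le> H j"
      using inc dec by (auto simp: incseq_def decseq_def)
    then show ?thesis using LH[of "max i j"] by linarith
  qed
  have bdd: "bdd_above (range L)" using LH'[of _ 0] by (intro bdd_aboveI[of _ "H 0"]) auto
  have x: "x \<in> {L k..H k}" for k
    unfolding x_def using cSUP_upper[OF _ bdd] LH' by (auto intro: cSUP_least)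
  have "x \<notin> U i" for i
  proof
    assume xU: "x \<in> U i"
    have "(\<lambda>k. (h\<^sub>0 - l\<^sub>0) / 2 ^ k) \<longlonglongrightarrow> 0"
      by (rule LIMSEQ_divide_realpow_zero) simp
    \<comment> \<open>On intervals no longer than this threshold the load of \<open>U i\<close>, if
      it is met, is capped at 1. Positivity of \<open>e i\<close> is what makes the threshold
      reachable.\<close>
    moreover have "(C * e i) powr (1 / s) > 0" using C e(1)[of i] by simp
    ultimately have "eventually (\<lambda>k. (h\<^sub>0 - l\<^sub>0) / 2 ^ k < (C * e i) powr (1 / s)) sequentially"
      by (rule order_tendstoD(2))
    then obtain k where "(h\<^sub>0 - l\<^sub>0) / 2 ^ k < (C * e i) powr (1 / s)"
      by (auto simp: eventually_sequentially)
    then have "H k - L k \<le> (C * e i) powr (1 / s)" using node(5)[of k] by linarith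
    then have "(H k - L k) powr s \<le> ((C * e i) powr (1 / s)) powr s"
      using LH[of k] s by (intro powr_mono2) auto
    also have "\<dots> = C * e i" using s C e(1)[of i] by (simp add: powr_powr)
    finally have "1 \<le> C * e i / (H k - L k) powr s" using LH[of k] by simp
    then have "1 = cover_load s C (U i) (e i) (L k) (H k)"
      using xU x[of k] by (auto simp: cover_load_def)
    also have "\<dots> \<le> (\<Sum>i. cover_load s C (U i) (e i) (L k) (H k))"
      using sum_le_suminf[OF summ, of "{i}"] cover_load_nonneg[OF C0 less_imp_le[OF e(1)]] by simp
    finally show False using node(2)[of k] by (simp add: light_def)
  qed
  then show ?thesis using x node by blast
qed

section \<open>Increments of power functions with exponent at most 1\<close>

text \<open>By the mean value theorem, since the derivative is decreasing for
  \<open>p \<le> 1\<close>: the left end gives the upper bound here, the right end the lower bound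
  in the next lemma.\<close>

lemma powr_diff_le:
  fixes p t h :: real
  assumes "0 < p" "p \<le> 1" "0 < t" "0 \<le> h"
  shows "(t + h) powr p - t powr p \<le> p * h * t powr (p - 1)"
proof (cases "h = 0")
  case False
  have "\<exists>z. t < z \<and> z < t + h \<and> (t + h) powr p - t powr p = (t + h - t) * (p * z powr (p - 1))"
    using assms False by (intro MVT2) (auto intro!: derivative_eq_intros)
  then obtain z where z: "t < z" "(t + h) powr p - t powr p = h * (p * z powr (p - 1))" by auto
  have "z powr (p - 1) \<le> t powr (p - 1)" using z assms by (intro powr_mono2') auto
  then have "h * p * z powr (p - 1) \<le> h * p * t powr (p - 1)" using assms by (intro mult_left_mono) auto
  then show ?thesis using z by (simp add: mult_ac)
qed simp

lemma powr_diff_ge: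
  fixes p t h :: real
  assumes "0 < p" "p \<le> 1" "0 < t" "0 \<le> h"
  shows "p * h * (t + h) powr (p - 1) \<le> (t + h) powr p - t powr p"
proof (cases "h = 0")
  case False
  have "\<exists>z. t < z \<and> z < t + h \<and> (t + h) powr p - t powr p = (t + h - t) * (p * z powr (p - 1))"
    using assms False by (intro MVT2) (auto intro!: derivative_eq_intros)
  then obtain z where z: "t < z" "z < t + h" "(t + h) powr p - t powr p = h * (p * z powr (p - 1))"
    by auto
  have "(t + h) powr (p - 1) \<le> z powr (p - 1)" using z assms by (intro powr_mono2') auto
  then have "h * p * (t + h) powr (p - 1) \<le> h * p * z powr (p - 1)"
    using assms by (intro mult_left_mono) auto
  then show ?thesis using z by (simp add: mult_ac)
qed simp

text \<open>As \<open>p - 1 \<ge> -1\<close>, enlarging the base by a factor \<open>c\<close> costs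
  the derivative at most a factor \<open>c\<close>. This makes the upper and lower bounds for
  increments comparable.\<close>

lemma powr_scaled_ge:
  fixes p t c :: real
  assumes "0 < p" "p \<le> 1" "0 < t" "1 \<le> c" "0 < x" "x \<le> c * t"
  shows "t powr (p - 1) / c \<le> x powr (p - 1)"
proof -
  have "c powr (-1) \<le> c powr (p - 1)" using assms by (intro powr_mono) auto
  then have "1 / c \<le> c powr (p - 1)" using assms by (simp add: powr_minus_divide)
  then have "t powr (p - 1) * (1 / c) \<le> t powr (p - 1) * c powr (p - 1)"
    by (intro mult_left_mono) auto
  also have "\<dots> = (c * t) powr (p - 1)" using assms by (simp add: powr_mult mult_ac)
  also have "\<dots> \<le> x powr (p - 1)" using assms by (intro powr_mono2') auto
  finally show ?thesis by simp
qed

section \<open>The upper bound for the dimension\<close>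

lemma E_set_subset_nonneg: "E_set q r \<subseteq> {0..}"
  by (auto simp: E_set_def)

text \<open>Adjacent intervals of lengths \<open>c / Suc i\<close> cover the half-line because the
  harmonic series diverges, while for \<open>s > 1\<close> their s-sum is \<open>c powr s\<close>
  times a convergent series. It tends to 0 with \<open>c\<close>.\<close>

lemma hausdorff_measure_real_eq_0:
  fixes s :: real and E :: "real set"
  assumes s: "1 < s" and E: "E \<subseteq> {0..}"
  shows "hausdorff_measure s E = 0"
proof -
  define Z where "Z = (\<Sum>i::nat. 1 / real (Suc i) powr s)"
  have sum0: "summable (\<lambda>i::nat. 1 / real (Suc i) powr s)"
  proof -
    have "summable (\<lambda>i. real i powr (- s))" using s by (simp add: summable_real_powr_iff)
    then have "summable (\<lambda>i. real (Suc i) powr (- s))" by (subst summable_Suc_iff)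
    then show ?thesis by (simp add: powr_minus_divide)
  qed
  have bound: "hausdorff_premeasure s \<delta> E \<le> ennreal (c powr s * Z)" if c: "0 < c" "c \<le> \<delta>" for c \<delta>
  proof -
    define U where "U = (\<lambda>i. {c * harm i..c * harm (Suc i)} :: real set)"
    have len: "c * harm (Suc i) - c * harm i = c / real (Suc i)" for i
      by (simp add: harm_Suc algebra_simps divide_inverse)
    have diam: "diameter (U i) = c / real (Suc i)" for i
    proof -
      have "c * harm i \<le> c * harm (Suc i)" 
        using c by (intro mult_left_mono harm_mono) auto
      then show ?thesis unfolding U_def by (subst diameter_closed_interval) (use len[of i] in auto)
    qed
    have "x \<in> (\<Union>i. U i)" if "0 \<le> x" for x
    proof -
      have "eventually (\<lambda>n. x / c < harm n) at_top"
        using harm_at_top by (auto simp: filterlim_at_top_dense)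
      then obtain n where "x / c < harm n" by (auto simp: eventually_sequentially)
      then have ex: "x < c * harm n" using c by (simp add: field_simps)
      \<comment> \<open>The first harmonic endpoint beyond \<open>x\<close>; it is not the one at 0
        because \<open>harm 0 = 0\<close>, so \<open>x\<close> lies in the interval just before
        it.\<close>
      define m where "m = (LEAST n. x < c * harm n)"
      have m: "x < c * harm m" unfolding m_def using ex by (rule LeastI)
      then have "m \<noteq> 0" using that by (intro notI) (simp add: harm_def)
      then obtain k where k: "m = Suc k" by (cases m) auto
      have "\<not> x < c * harm k" using not_less_Least[of k "\<lambda>n. x < c * harm n"] k by (simp add: m_def)
      then show ?thesis using m k by (auto simp: U_def intro!: exI[of _ k])
    qed
    moreover have "c / real (Suc i) \<le> \<delta>" for i
      using c frac_le[of c c 1 "real (Suc i)"] by simp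
    moreover have "bounded (U i)" for i by (simp add: U_def)
    ultimately have "U \<in> delta_covers \<delta> E"
      using E unfolding delta_covers_def diam[symmetric] by blast
    then have "hausdorff_premeasure s \<delta> E \<le> (\<Sum>i. ennreal (diam_pow s (U i)))"
      unfolding hausdorff_premeasure_def by (rule INF_lower)
    also have "\<dots> \<le> (\<Sum>i. ennreal (c powr s * (1 / real (Suc i) powr s)))"
    proof (intro suminf_le ennreal_leI)
      show "diam_pow s (U i) \<le> c powr s * (1 / real (Suc i) powr s)" for i
        using s c by (simp add: diam_pow_def diam powr_divide)
    qed auto
    also have "\<dots> = ennreal (\<Sum>i. c powr s * (1 / real (Suc i) powr s))"
      by (intro suminf_ennreal2 summable_mult sum0) auto
    also have "\<dots> = ennreal (c powr s * Z)" unfolding Z_def using sum0 by (subst suminf_mult) auto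
    finally show ?thesis .
  qed
  have "hausdorff_premeasure s \<delta> E = 0" if "\<delta> > 0" for \<delta>
  proof -
    have "((\<lambda>c. c powr s * Z) \<longlongrightarrow> 0 powr s * Z) (at_right 0)"
      using s by (intro tendsto_intros) (auto simp: eventually_at_filter)
    then have "((\<lambda>c. ennreal (c powr s * Z)) \<longlongrightarrow> ennreal 0) (at_right 0)"
      using s by (intro tendsto_ennrealI) simp
    moreover have "eventually (\<lambda>c. hausdorff_premeasure s \<delta> E \<le> ennreal (c powr s * Z)) (at_right 0)"
      unfolding eventually_at_right_field using bound that
      by (intro exI[of _ \<delta>]) auto
    ultimately have "hausdorff_premeasure s \<delta> E \<le> ennreal 0"
      by (intro tendsto_lowerbound) auto
    then show ?thesis by simp
  qed
  then show ?thesis by (simp add: hausdorff_measure_def)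
qed

section \<open>One step of the tree: subdividing a cell at the next exponent\<close>

text \<open>Raising to the power \<open>q + d\<close> stretches \<open>[l, h]\<close> over many unit
  cells, and the children are the preimages of the initial pieces of length \<open>\<eta>'\<close>
  of these cells. Relative to the parent a child has length at most \<open>2 * d / b powr d\<close>.
  The hypothesis \<open>grow\<close> lets the power \<open>1 - s\<close> of this ratio absorb the
  losses, which are only of order \<open>d\<close>.\<close>

lemma powr_cells_well_spread:
  fixes q d \<eta> \<eta>' b s a \<rho> :: real
  assumes q: "1 \<le> q" and d: "1 \<le> d" and \<eta>: "0 < \<eta>" "\<eta> \<le> 1" "1 \<le> \<eta> * d"
    and \<eta>': "0 < \<eta>'" "\<eta>' \<le> 1" "1 \<le> \<eta>' * d"
    and s: "0 < s" "s < 1" and grow: "16 * d\<^sup>2 \<le> b powr (d * (1 - s))"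
    and b: "1 < b" "b \<le> a powr (1 / q)" and a: "0 < a"
  defines "l \<equiv> a powr (1 / q)" and "h \<equiv> (a + \<eta>) powr (1 / q)"
  shows "\<exists>K (m::int) w. 1 \<le> \<rho> + m \<and>
    well_spread s 10 l h K (\<lambda>k. (\<rho> + m + k) powr (1 / (q + d))) (\<lambda>k. (\<rho> + m + k + \<eta>') powr (1 / (q + d))) w"
proof -
  define Q p where "Q = q + d" and "p = 1 / Q"
  have Q: "1 \<le> Q" and p: "0 < p" "p \<le> 1" using q d by (auto simp: Q_def p_def)
  \<comment> \<open>\<open>[A, B]\<close> is the image of \<open>[l, h]\<close> under the power
    \<open>Q\<close>, and \<open>\<delta>\<close> is the slope of the inverse map at
    \<open>A\<close>. That slope decreases, so \<open>\<delta>\<close> bounds the length of the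
    preimage of every unit cell in \<open>[A, B]\<close>.\<close>
  define H A B \<delta> where "H = h - l" and "A = l powr Q" and "B = h powr Q" and "\<delta> = p * A powr (p - 1)"
  have l1: "1 < l" "b \<le> l" using b by (auto simp: l_def)
  have lh: "l < h" unfolding l_def h_def using a \<eta> q by (intro powr_less_mono2) auto
  have H0: "0 < H" using lh by (simp add: H_def)
  have A1: "1 \<le> A" unfolding A_def using l1 Q by (intro ge_one_powr_ge_zero) auto
  have AB: "A < B" unfolding A_def B_def using l1 lh Q by (intro powr_less_mono2) auto
  have gA: "A powr p = l" and gB: "B powr p = h"
    using l1 lh Q by (auto simp: A_def B_def p_def powr_powr)
  have alq: "a = l powr q" using a q by (simp add: l_def powr_powr)
  have a1: "1 \<le> a" unfolding alq using l1 q by (intro ge_one_powr_ge_zero) auto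
  have \<delta>0: "0 < \<delta>" using p A1 by (simp add: \<delta>_def)
  \<comment> \<open>Up to the factors \<open>1 / Q\<close> and \<open>1 / q\<close>, the slopes at
    the two exponents differ by \<open>l powr d\<close>. The parent length \<open>H\<close> is at
    least about \<open>\<eta>\<close> times the slope at exponent \<open>q\<close>, and
    \<open>\<eta> \<ge> 1 / d\<close>; the 2 comes from
    \<open>a + \<eta> \<le> 2 * a\<close>.\<close>
  have \<delta>H: "\<delta> * l powr d \<le> 2 * d * H"
  proof -
    have "A powr (p - 1) * l powr d = l powr (1 - q)"
      using l1 Q by (simp add: A_def powr_powr powr_add[symmetric] p_def algebra_simps) (simp add: Q_def)
    also have "\<dots> = a powr (1 / q - 1)" using q a by (simp add: l_def powr_powr diff_divide_distrib)
    finally have "\<delta> * l powr d = p * a powr (1 / q - 1)" by (simp add: \<delta>_def)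
    also have "\<dots> \<le> 1 / q * a powr (1 / q - 1)"
      using q d by (intro mult_right_mono) (auto simp: p_def Q_def field_simps)
    also have "\<dots> \<le> (\<eta> * d) * (1 / q * a powr (1 / q - 1))"
    proof -
      have "0 \<le> 1 / q * a powr (1 / q - 1)" using q by simp
      from mult_right_mono[OF \<eta>(3) this] show ?thesis by (simp only: mult_1)
    qed
    also have "\<dots> = 2 * d * (1 / q * \<eta> * (a powr (1 / q - 1) / 2))" by simp
    also have "\<dots> \<le> 2 * d * (1 / q * \<eta> * (a + \<eta>) powr (1 / q - 1))"
      using powr_scaled_ge[of "1 / q" a 2 "a + \<eta>"] q a a1 \<eta> d
      by (intro mult_left_mono) auto
    also have "\<dots> \<le> 2 * d * H"
      using powr_diff_ge[of "1 / q" a \<eta>] q a \<eta> d by (intro mult_left_mono) (auto simp: H_def h_def l_def)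
    finally show ?thesis .
  qed
  have \<delta>b: "\<delta> \<le> 2 * d * H / b powr d"
  proof -
    have "b powr d \<le> l powr d" using b l1 d by (intro powr_mono2) auto
    then have "\<delta> * b powr d \<le> \<delta> * l powr d" using \<delta>0 by simp
    then show ?thesis using \<delta>H b by (simp add: field_simps)
  qed
  have bd: "16 * d\<^sup>2 \<le> b powr d"
  proof -
    have "b powr (d * (1 - s)) \<le> b powr d" using b d s by (intro powr_mono) auto
    then show ?thesis using grow by linarith
  qed
  have \<delta>8: "8 * \<delta> \<le> H"
  proof -
    have "d * 16 \<le> d * (16 * d)" using d by (intro mult_left_mono) auto
    then have "16 * d \<le> b powr d" using bd by (simp add: power2_eq_square)
    then have "H * (16 * d) \<le> H * b powr d" using H0 by simp
    then have "8 * (2 * d * H / b powr d) \<le> H" using b by (simp add: field_simps)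
    then show ?thesis using \<delta>b by linarith
  qed
  \<comment> \<open>The cells start at the first point of \<open>[A, B]\<close> congruent to
    \<open>\<rho>\<close> modulo 1, and \<open>K\<close> counts the whole unit cells that fit from
    there.\<close>
  define m where "m = \<lceil>A - \<rho>\<rceil>"
  define a0 where "a0 = \<rho> + m"
  have a0: "A \<le> a0" "a0 < A + 1" unfolding a0_def m_def by linarith+
  define K where "K = nat \<lfloor>B - a0\<rfloor>"
  define t where "t = (\<lambda>k::nat. (a0 + k) powr p)"
  define v where "v = (\<lambda>k::nat. (a0 + k + \<eta>') powr p)"
  have slope: "p * x powr (p - 1) \<le> \<delta>" if "A \<le> x" for x
    unfolding \<delta>_def using p A1 that by (intro mult_left_mono powr_mono2') auto
  have AB4: "4 < B - A"
  proof (rule ccontr)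
    assume "\<not> ?thesis"
    then have "\<delta> * (B - A) \<le> \<delta> * 4" using \<delta>0 by (intro mult_left_mono) auto
    moreover have "H \<le> \<delta> * (B - A)"
      using powr_diff_le[of p A "B - A"] p A1 AB gA gB by (simp add: H_def \<delta>_def mult_ac)
    ultimately show False using \<delta>8 \<delta>0 by linarith
  qed
  have K: "a0 + K \<le> B" "B < a0 + K + 1" "0 < K"
    using AB4 a0 unfolding K_def by linarith+
  have tstep: "t (Suc k) - t k \<le> p * (a0 + k) powr (p - 1)"
    "p * (a0 + k + 1) powr (p - 1) \<le> t (Suc k) - t k" for k
    using powr_diff_le[of p "a0 + k" 1] powr_diff_ge[of p "a0 + k" 1] p a0 A1
    by (auto simp: t_def add_ac)
  have tmono: "t i \<le> t j" if "i \<le> j" for i j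
    unfolding t_def using that a0 A1 p by (intro powr_mono2) auto
  have tless: "t i < t j" if "i < j" for i j
    unfolding t_def using that a0 A1 p by (intro powr_less_mono2) auto
  have lt0: "l \<le> t 0" unfolding gA[symmetric] t_def using a0 A1 p by (intro powr_mono2) auto
  have tKh: "t K \<le> h" unfolding gB[symmetric] t_def using K a0 A1 p by (intro powr_mono2) auto
  define L where "L = t K - t 0"
  \<comment> \<open>Only an incomplete cell at each end is lost, each of preimage length at most
    \<open>\<delta>\<close>.\<close>
  have L: "H / 2 \<le> L"
  proof -
    have "t 0 - l \<le> p * (a0 - A) * A powr (p - 1)"
      using powr_diff_le[of p A "a0 - A"] p A1 a0 gA by (simp add: t_def)
    also have "\<dots> = (a0 - A) * \<delta>" by (simp add: \<delta>_def)
    also have "\<dots> \<le> 1 * \<delta>" using a0 \<delta>0 by (intro mult_right_mono) auto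
    finally have 1: "t 0 - l \<le> \<delta>" by simp
    have "h - t K \<le> p * (B - (a0 + K)) * (a0 + K) powr (p - 1)"
      using powr_diff_le[of p "a0 + K" "B - (a0 + K)"] p A1 a0 K gB by (simp add: t_def)
    also have "\<dots> = (B - (a0 + K)) * (p * (a0 + K) powr (p - 1))" by simp
    also have "\<dots> \<le> 1 * \<delta>" using a0 K p \<delta>0 by (intro mult_mono slope) auto
    finally have "h - t K \<le> \<delta>" by simp
    then have "H - L \<le> 2 * \<delta>" using 1 unfolding L_def H_def by linarith
    then show ?thesis using \<delta>8 H0 by linarith
  qed
  have L0: "0 < L" using L H0 by linarith
  \<comment> \<open>The weight uses the whole cell and not only the child inside it, so sums of
    weights telescope.\<close>
  define w where "w = (\<lambda>k. (t (Suc k) - t k) / L)"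
  have tv: "t k < v k" "v k \<le> t (Suc k)" for k
    unfolding t_def v_def using a0 A1 p \<eta>' by (auto intro!: powr_less_mono2 powr_mono2)
  have vt_le: "v k - t k \<le> \<delta>" for k
  proof -
    have "v k - t k \<le> p * \<eta>' * (a0 + k) powr (p - 1)"
      using powr_diff_le[of p "a0 + k" \<eta>'] p a0 A1 \<eta>' by (simp add: t_def v_def)
    also have "\<dots> = \<eta>' * (p * (a0 + k) powr (p - 1))" by simp
    also have "\<dots> \<le> 1 * \<delta>" using a0 p \<eta>' by (intro mult_mono slope) auto
    finally show ?thesis by simp
  qed
  have vt_ge: "\<eta>' * (t (Suc k) - t k) \<le> 2 * (v k - t k)" for k
  proof -
    have "\<eta>' * (t (Suc k) - t k) \<le> \<eta>' * (p * (a0 + k) powr (p - 1))"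
      using tstep(1)[of k] \<eta>' by (intro mult_left_mono) auto
    also have "\<dots> = 2 * (p * \<eta>' * ((a0 + k) powr (p - 1) / 2))" by simp
    also have "\<dots> \<le> 2 * (p * \<eta>' * (a0 + k + \<eta>') powr (p - 1))"
      using powr_scaled_ge[of p "a0 + k" 2 "a0 + k + \<eta>'"] p a0 A1 \<eta>'
      by (intro mult_left_mono) auto
    also have "\<dots> \<le> 2 * (v k - t k)"
      using powr_diff_ge[of p "a0 + k" \<eta>'] p a0 A1 \<eta>' by (simp add: t_def v_def)
    finally show ?thesis .
  qed
  \<comment> \<open>With \<open>c\<close> the relative length of the child, \<open>w k\<close> is at
    most a multiple of \<open>d * c\<close>: the child fills at least \<open>\<eta>' / 2\<close> of
    its cell, \<open>\<eta>' * d \<ge> 1\<close> and \<open>L \<ge> H / 2\<close>. Splitting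
    \<open>c\<close> as \<open>c powr (1 - s) * c powr s\<close>, the first factor is at most
    \<open>1 / (8 * d)\<close>.\<close>
  have weight: "2 * w k * H powr s \<le> (v k - t k) powr s" for k
  proof -
    define c where "c = (v k - t k) / H"
    have c0: "0 < c" using tv(1)[of k] H0 by (simp add: c_def)
    have "\<delta> / H \<le> 2 * d / b powr d" using \<delta>b H0 by (simp add: field_simps)
    moreover have "c \<le> \<delta> / H" unfolding c_def using vt_le[of k] H0 by (intro divide_right_mono) auto
    ultimately have "c \<le> 2 * d / b powr d" by linarith
    then have "c powr (1 - s) \<le> (2 * d / b powr d) powr (1 - s)" using c0 s by (intro powr_mono2) auto
    also have "\<dots> = (2 * d) powr (1 - s) / b powr (d * (1 - s))" using b d by (simp add: powr_divide powr_powr)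
    also have "\<dots> \<le> (2 * d) powr 1 / (16 * d\<^sup>2)"
      using d s grow by (intro frac_le powr_mono) auto
    also have "\<dots> = 1 / (8 * d)" using d by (simp add: power2_eq_square)
    finally have c1: "8 * d * c powr (1 - s) \<le> 1" using d by (simp add: field_simps)
    have "t (Suc k) - t k \<le> (\<eta>' * d) * (t (Suc k) - t k)"
      using mult_right_mono[OF \<eta>'(3), of "t (Suc k) - t k"] tmono[of k "Suc k"] by simp
    also have "\<dots> \<le> d * (2 * (v k - t k))"
      using mult_left_mono[OF vt_ge[of k], of d] d by (simp add: mult_ac)
    finally have "2 * (t (Suc k) - t k) \<le> 4 * d * (v k - t k)"
      by (simp add: algebra_simps)
    from divide_right_mono[OF this less_imp_le[OF L0]]
    have "2 * w k \<le> 4 * d * (v k - t k) / L" by (simp add: w_def)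
    also have "\<dots> \<le> 4 * d * (v k - t k) / (H / 2)"
      using L H0 d tv(1)[of k] by (intro divide_left_mono) auto
    also have "\<dots> = 8 * d * c" by (simp add: c_def)
    also have "\<dots> = (8 * d * c powr (1 - s)) * c powr s" using c0 by (simp add: powr_add[symmetric])
    also have "\<dots> \<le> 1 * c powr s" using c1 by (intro mult_right_mono) auto
    also have "\<dots> = (v k - t k) powr s / H powr s" using H0 tv(1)[of k] by (simp add: c_def powr_divide)
    finally show ?thesis using H0 by (simp add: field_simps)
  qed
  \<comment> \<open>The gap \<open>D\<close> contains the whole cells strictly between
    \<open>i\<close> and \<open>j\<close>. Cell \<open>i\<close> is at most 3 times as long as its
    successor, since \<open>a0 \<ge> 1\<close> gives \<open>a0 + i + 2 \<le> 3 * (a0 + i)\<close>,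
    and cell \<open>j\<close> is no longer than its predecessor. Hence cells \<open>i\<close> to
    \<open>j\<close> have length at most \<open>3 * D + D + D\<close>, and
    \<open>L \<ge> H / 2\<close> turns 5 into 10.\<close>
  have spread: "v i \<le> t j \<and> sum w {i..j} * H powr s \<le> 10 * (t j - v i) powr s"
    if ij: "i + 2 \<le> j" "j < K" for i j
  proof -
    have vi: "v i \<le> t (Suc i)" by (rule tv)
    have i2: "t (Suc (Suc i)) \<le> t j" and j1: "t (Suc i) \<le> t (j - 1)" using ij by (auto intro!: tmono)
    define D where "D = t j - v i"
    have left: "t (Suc i) - t i \<le> 3 * (t (Suc (Suc i)) - t (Suc i))"
    proof -
      have "(a0 + i) powr (p - 1) / 3 \<le> (a0 + Suc i + 1) powr (p - 1)"
        using p a0 A1 by (intro powr_scaled_ge) auto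
      then have "p * ((a0 + i) powr (p - 1) / 3) \<le> p * (a0 + Suc i + 1) powr (p - 1)"
        using p by (intro mult_left_mono) auto
      then show ?thesis using tstep(1)[of i] tstep(2)[of "Suc i"] by argo
    qed
    have right: "t (Suc j) - t j \<le> t j - t (j - 1)"
      using tstep(1)[of j] tstep(2)[of "j - 1"] ij by (simp add: of_nat_diff)
    have "t (Suc j) - t i \<le> 5 * D" using left right vi i2 j1 unfolding D_def by argo
    moreover have "sum w {i..j} = (t (Suc j) - t i) / L"
    proof -
      have "sum w {i..j} = (\<Sum>k=i..j. t (Suc k) - t k) / L" by (simp add: w_def sum_divide_distrib)
      then show ?thesis using ij by (simp add: sum_Suc_diff)
    qed
    ultimately have "sum w {i..j} \<le> 5 * D / L" using L0 by (simp add: divide_right_mono)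
    also have "\<dots> \<le> 5 * D / (H / 2)"
      using L H0 L0 i2 vi tless[of "Suc i" "Suc (Suc i)"] by (intro divide_left_mono) (auto simp: D_def)
    also have "\<dots> = 10 * (D / H)" by simp
    also have "\<dots> \<le> 10 * (D / H) powr s"
    proof -
      have "0 < D / H" using H0 i2 vi tless[of "Suc i" "Suc (Suc i)"] by (simp add: D_def)
      moreover have "D \<le> H"
        using tKh lt0 tmono[of j K] tmono[of 0 i] tv(1)[of i] ij unfolding D_def H_def by linarith
      then have "D / H \<le> 1" using H0 by simp
      ultimately have "(D / H) powr 1 \<le> (D / H) powr s" using s by (intro powr_mono') auto
      then have "D / H \<le> (D / H) powr s" unfolding powr_one[OF less_imp_le[OF \<open>0 < D / H\<close>]] .
      then show ?thesis by (intro mult_left_mono) auto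
    qed
    also have "\<dots> = 10 * D powr s / H powr s"
      using H0 i2 vi tless[of "Suc i" "Suc (Suc i)"] by (simp add: powr_divide D_def)
    finally have "sum w {i..j} * H powr s \<le> 10 * D powr s" using H0 by (simp add: field_simps)
    then show ?thesis using i2 vi tless[of "Suc i" "Suc (Suc i)"] by (simp add: D_def)
  qed
  have "well_spread s 10 l h K t v w"
    unfolding well_spread_def
  proof (intro conjI allI impI)
    show "l < h" by fact
    have "sum w {..<K} = (\<Sum>k<K. t (Suc k) - t k) / L" by (simp add: w_def sum_divide_distrib)
    then show "sum w {..<K} = 1" using L0 by (simp add: sum_lessThan_telescope L_def)
    fix k assume k: "k < K"
    show "l \<le> t k" using lt0 tmono[of 0 k] by simp
    show "t k < v k" by (rule tv)
    show "v k \<le> h" using tv(2)[of k] tKh tmono[of "Suc k" K] k by simp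
    show "v k - t k \<le> (h - l) / 2" using vt_le[of k] \<delta>8 \<delta>0 unfolding H_def[symmetric] by linarith
    show "0 < w k" using tless[of k "Suc k"] L0 by (simp add: w_def)
    show "2 * w k * (h - l) powr s \<le> (v k - t k) powr s" using weight by (simp add: H_def)
  next
    fix i j assume "i + 2 \<le> j" "j < K"
    from spread[OF this] show "v i \<le> t j"
      "sum w {i..j} * (h - l) powr s \<le> 10 * (t j - v i) powr s" by (auto simp: H_def)
  qed
  moreover have "1 \<le> \<rho> + m" using a0 A1 by (simp add: a0_def)
  ultimately show ?thesis unfolding t_def v_def a0_def p_def Q_def by blast
qed

section \<open>Limit points of the tree lie in the set\<close>

text \<open>The bound \<open>\<kappa>\<close> comes from the root interval alone and precedes the
  choice of the cover. Thus one statement yields both positive measure and, with empty sets,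
  density.\<close>

lemma E_set_avoids_cover:
  fixes q r :: "nat \<Rightarrow> real"
  assumes gap: "filterlim (\<lambda>n. q (n + 1) - q n) at_top sequentially"
    and s: "0 < s" "s < 1" and bc: "1 < b" "b < c"
  shows "\<exists>\<kappa>>0. \<forall>U e. (\<forall>i::nat. bounded (U i) \<and> 0 < e i \<and> diameter (U i) powr s \<le> e i) \<longrightarrow>
    summable e \<longrightarrow> suminf e < \<kappa> \<longrightarrow> (\<exists>x\<in>E_set q r \<inter> {b..c}. \<forall>i. x \<notin> U i)"
proof -
  define d where "d = (\<lambda>n. q (n + 1) - q n)"
  \<comment> \<open>Level \<open>n\<close> is a child across the gap \<open>d (n - 1)\<close> and a
    parent across \<open>d n\<close>, and \<open>\<eta> n\<close> must be at least the inverse of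
    both. At \<open>n = 0\<close> truncated subtraction makes \<open>d (n - 1)\<close> equal to
    \<open>d 0\<close>, which does not affect large \<open>n\<close>.\<close>
  define g where "g = (\<lambda>n. min (d n) (d (n - 1)))"
  define \<eta> where "\<eta> = (\<lambda>n. 1 / g n)"
  have dlim: "filterlim d at_top sequentially" using gap by (simp add: d_def)
  have dlim': "filterlim (\<lambda>n. d (n - 1)) at_top sequentially"
    using dlim by (subst filterlim_sequentially_Suc[symmetric]) simp
  have glim: "filterlim g at_top sequentially"
    unfolding filterlim_at_top
  proof
    fix Z
    show "eventually (\<lambda>n. Z \<le> g n) sequentially"
      using dlim[unfolded filterlim_at_top, rule_format, of Z]
        dlim'[unfolded filterlim_at_top, rule_format, of Z]
      by eventually_elim (simp add: g_def)
  qed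
  have \<eta>lim: "\<eta> \<longlonglongrightarrow> 0" unfolding \<eta>_def
    by (rule tendsto_divide_0[OF tendsto_const filterlim_at_top_imp_at_infinity[OF glim]])
  have qlim: "filterlim q at_top sequentially"
  proof -
    obtain M where M: "\<And>n. n \<ge> M \<Longrightarrow> 1 \<le> d n"
      using dlim[unfolded filterlim_at_top, rule_format, of 1] by (auto simp: eventually_sequentially)
    have "q M + real k \<le> q (k + M)" for k
    proof (induction k)
      case (Suc k)
      then show ?case using M[of "k + M"] by (simp add: d_def)
    qed simp
    moreover have "filterlim (\<lambda>k. q M + real k) at_top sequentially"
      by (intro filterlim_tendsto_add_at_top[OF tendsto_const] filterlim_real_sequentially)
    ultimately have "filterlim (\<lambda>k. q (k + M)) at_top sequentially"
      by (rule filterlim_at_top_mono[rotated, OF always_eventually, OF allI])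
    then show ?thesis
      unfolding filterlim_at_top by (subst (asm) eventually_sequentially_seg)
  qed
  have "eventually (\<lambda>x::real. 16 * x\<^sup>2 \<le> b powr (x * (1 - s))) at_top"
    using bc s by real_asymp
  then have ev1: "eventually (\<lambda>n. 16 * (d n)\<^sup>2 \<le> b powr (d n * (1 - s))) sequentially"
    using dlim by (rule eventually_compose_filterlim)
  have "eventually (\<lambda>x::real. 3 \<le> (c / b) powr x) at_top"
  proof -
    have "eventually (\<lambda>x::real. 3 \<le> y powr x) at_top" if "1 < y" for y :: real
      using that by real_asymp
    then show ?thesis using bc by simp
  qed
  \<comment> \<open>This leaves room for the root inside \<open>[b, c]\<close>: in the proof of
    \<open>root\<close>, the power \<open>q N\<close> of its right end is at most
    \<open>A + 2 \<le> 3 * A\<close> with \<open>A = b powr q N\<close>.\<close>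
  then have ev2: "eventually (\<lambda>n. 3 \<le> (c / b) powr q n) sequentially"
    using qlim by (rule eventually_compose_filterlim)
  have ev: "eventually (\<lambda>n. 16 * (d n)\<^sup>2 \<le> b powr (d n * (1 - s)) \<and> 3 \<le> (c / b) powr q n \<and>
      1 \<le> g n \<and> 1 \<le> q n) sequentially"
    using ev1 ev2 glim[unfolded filterlim_at_top, rule_format, of 1]
      qlim[unfolded filterlim_at_top, rule_format, of 1]
    by eventually_elim auto
  obtain N where N: "\<And>n. n \<ge> N \<Longrightarrow> 16 * (d n)\<^sup>2 \<le> b powr (d n * (1 - s))"
    "\<And>n. n \<ge> N \<Longrightarrow> 3 \<le> (c / b) powr q n" "\<And>n. n \<ge> N \<Longrightarrow> 1 \<le> g n" "\<And>n. n \<ge> N \<Longrightarrow> 1 \<le> q n"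
    using ev unfolding eventually_sequentially by blast
  have d1: "1 \<le> d n" if "n \<ge> N" for n using N(3)[OF that] by (simp add: g_def)
  have \<eta>1: "0 < \<eta> n" "\<eta> n \<le> 1" "1 \<le> \<eta> n * d n" if "n \<ge> N" for n
    using N(3)[OF that] by (auto simp: \<eta>_def g_def)
  have \<eta>2: "1 \<le> \<eta> (Suc n) * d n" if "n \<ge> N" for n
    using N(3)[of "Suc n"] that by (auto simp: \<eta>_def g_def)
  define G where "G = (\<lambda>n l h. N \<le> n \<and> b \<le> l \<and> (\<exists>m::int. 0 < r n + m \<and>
    l = (r n + m) powr (1 / q n) \<and> h = (r n + m + \<eta> n) powr (1 / q n)))"
  have tree: "\<exists>K u v w. well_spread s 10 l h K u v w \<and> (\<forall>k<K. G (Suc n) (u k) (v k))"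
    if node: "G n l h" for n l h
  proof -
    obtain m :: int where n: "N \<le> n" "b \<le> l" and m: "0 < r n + m"
      and l: "l = (r n + m) powr (1 / q n)" and h: "h = (r n + m + \<eta> n) powr (1 / q n)"
      using node by (auto simp: G_def)
    have Sn: "N \<le> Suc n" using n by simp
    obtain K w and m' :: int where m': "1 \<le> r (Suc n) + m'"
      and spread: "well_spread s 10 l h K (\<lambda>k. (r (Suc n) + m' + k) powr (1 / (q n + d n)))
        (\<lambda>k. (r (Suc n) + m' + k + \<eta> (Suc n)) powr (1 / (q n + d n))) w"
      using powr_cells_well_spread[OF N(4)[OF n(1)] d1[OF n(1)] \<eta>1[OF n(1)] \<eta>1(1,2)[OF Sn]
          \<eta>2[OF n(1)] s N(1)[OF n(1)] bc(1) n(2)[unfolded l] m, of "r (Suc n)"]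
      unfolding l h by blast
    have qS: "q n + d n = q (Suc n)" by (simp add: d_def)
    have "G (Suc n) ((r (Suc n) + m' + k) powr (1 / q (Suc n)))
        ((r (Suc n) + m' + k + \<eta> (Suc n)) powr (1 / q (Suc n)))" if "k < K" for k
    proof -
      \<comment> \<open>Children lie inside their parent, so the lower bound \<open>b\<close> passes
        down the tree.\<close>
      have "l \<le> (r (Suc n) + m' + k) powr (1 / q (Suc n))"
        using spread that unfolding well_spread_def qS by blast
      then show ?thesis unfolding G_def using n m' Sn
        by (intro conjI exI[of _ "m' + int k"]) (auto simp: add_ac)
    qed
    then show ?thesis using spread unfolding qS by blast
  qed
  obtain l\<^sub>0 h\<^sub>0 where root: "G N l\<^sub>0 h\<^sub>0" and h0: "h\<^sub>0 \<le> c"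
  proof -
    define A where "A = b powr q N"
    define m where "m = \<lceil>A - r N\<rceil>"
    define a where "a = r N + m"
    have qN: "1 \<le> q N" by (rule N) simp
    have A1: "1 \<le> A" unfolding A_def using bc qN by (intro ge_one_powr_ge_zero) auto
    have a: "A \<le> a" "a < A + 1" unfolding a_def m_def by linarith+
    have Ab: "A powr (1 / q N) = b" using bc qN by (simp add: A_def powr_powr)
    have "b \<le> a powr (1 / q N)"
      using a A1 qN powr_mono2[of "1 / q N" A a] by (simp add: Ab)
    then have "G N (a powr (1 / q N)) ((a + \<eta> N) powr (1 / q N))"
      unfolding G_def using a A1 by (auto simp: a_def intro!: exI[of _ m])
    moreover have "(a + \<eta> N) powr (1 / q N) \<le> c"
    proof -
      have "c powr q N = A * (c / b) powr q N" using bc by (simp add: A_def powr_divide)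
      moreover have "A * 3 \<le> A * (c / b) powr q N"
        using N(2)[of N] A1 by (intro mult_left_mono) auto
      ultimately have "a + \<eta> N \<le> c powr q N" using a A1 \<eta>1(2)[OF order_refl] by linarith
      then have "(a + \<eta> N) powr (1 / q N) \<le> (c powr q N) powr (1 / q N)"
        using a A1 \<eta>1(1)[of N] qN by (intro powr_mono2) auto
      then show ?thesis using bc qN by (simp add: powr_powr)
    qed
    ultimately show thesis by (rule that)
  qed
  have l0: "b \<le> l\<^sub>0" using root by (simp add: G_def)
  have lh0: "l\<^sub>0 < h\<^sub>0" using tree[OF root] by (auto simp: well_spread_def)
  show ?thesis
  \<comment> \<open>The 10 is the constant \<open>C\<close> of the tree, so this is the smallness
    required for a light root.\<close>
  proof (intro exI[of _ "(h\<^sub>0 - l\<^sub>0) powr s / 10"] conjI allI impI)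
    show "0 < (h\<^sub>0 - l\<^sub>0) powr s / 10" using lh0 by simp
    fix U :: "nat \<Rightarrow> real set" and e :: "nat \<Rightarrow> real"
    assume Ue: "\<forall>i. bounded (U i) \<and> 0 < e i \<and> diameter (U i) powr s \<le> e i"
      and sum_e: "summable e" and small: "suminf e < (h\<^sub>0 - l\<^sub>0) powr s / 10"
    have "\<exists>x. (\<forall>i. x \<notin> U i) \<and> (\<forall>k. \<exists>l h. G (N + k) l h \<and> x \<in> {l..h} \<and> l\<^sub>0 \<le> l \<and> h \<le> h\<^sub>0)"
      by (rule well_spread_tree_avoids_cover[where C = 10 and s = s and e = e])
        (use tree root s Ue sum_e small in auto)
    then obtain x where xU: "\<And>i. x \<notin> U i"
      and x: "\<And>k. \<exists>l h. G (N + k) l h \<and> x \<in> {l..h} \<and> l\<^sub>0 \<le> l \<and> h \<le> h\<^sub>0" by blast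
    have xbc: "b \<le> x" "x \<le> c" using x[of 0] l0 h0 by auto
    have near: "dist_nearest_int (x powr q n - r n) \<le> \<eta> n" if "N \<le> n" for n
    proof -
      obtain l h where "G n l h" and xlh: "l \<le> x" "x \<le> h" using x[of "n - N"] \<open>N \<le> n\<close> by auto
      then obtain m :: int where m: "0 < r n + m" and l: "l = (r n + m) powr (1 / q n)"
        and h: "h = (r n + m + \<eta> n) powr (1 / q n)" by (auto simp: G_def)
      have qn: "1 \<le> q n" using N(4) that by simp
      have "l powr q n \<le> x powr q n" "x powr q n \<le> h powr q n"
        using xlh qn xbc bc by (auto intro!: powr_mono2 simp: l)
      moreover have "l powr q n = r n + m" "h powr q n = r n + m + \<eta> n"
        using m qn \<eta>1(1)[OF that] by (auto simp: l h powr_powr)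
      ultimately have "dist (x powr q n - r n) (of_int m) \<le> \<eta> n" by (simp add: dist_real_def)
      then show ?thesis unfolding dist_nearest_int_def by (rule infdist_le2[rotated]) simp
    qed
    have "(\<lambda>n. dist_nearest_int (x powr q n - r n)) \<longlonglongrightarrow> 0"
    proof (rule Lim_null_comparison[OF _ \<eta>lim])
      show "eventually (\<lambda>n. norm (dist_nearest_int (x powr q n - r n)) \<le> \<eta> n) sequentially"
        using eventually_ge_at_top[of N]
        by eventually_elim (use near in \<open>simp add: dist_nearest_int_def infdist_nonneg\<close>)
    qed
    then show "\<exists>x\<in>E_set q r \<inter> {b..c}. \<forall>i. x \<notin> U i"
      using xbc bc xU by (intro bexI[of _ x]) (auto simp: E_set_def)
  qed
qed

section \<open>From avoiding covers to positive Hausdorff measure\<close>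

lemma hausdorff_measure_pos:
  fixes E :: "real set"
  assumes s: "0 < s" and \<kappa>: "0 < \<kappa>"
    and avoid: "\<And>U e. (\<And>i::nat. bounded (U i) \<and> 0 < e i \<and> diameter (U i) powr s \<le> e i) \<Longrightarrow>
      summable e \<Longrightarrow> suminf e < \<kappa> \<Longrightarrow> \<exists>x\<in>E. \<forall>i. x \<notin> U i"
  shows "hausdorff_measure s E \<noteq> 0"
proof
  assume "hausdorff_measure s E = 0"
  then have "hausdorff_premeasure s 1 E = 0"
    unfolding hausdorff_measure_def by (simp add: SUP_eq_iff bot_ennreal[symmetric])
  then have "(INF U \<in> delta_covers 1 E. \<Sum>i. ennreal (diam_pow s (U i))) < ennreal (\<kappa> / 2)"
    using \<kappa> by (simp add: hausdorff_premeasure_def)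
  then obtain U where U: "U \<in> delta_covers 1 E"
    and lt: "(\<Sum>i. ennreal (diam_pow s (U i))) < ennreal (\<kappa> / 2)"
    by (auto simp: INF_less_iff)
  have nonneg: "0 \<le> diam_pow s (U i)" for i by (simp add: diam_pow_def)
  have summ: "summable (\<lambda>i. diam_pow s (U i))"
    using lt nonneg by (intro summable_suminf_not_top) auto
  have sum_lt: "(\<Sum>i. diam_pow s (U i)) < \<kappa> / 2"
    using lt nonneg summ \<kappa> suminf_nonneg[OF summ nonneg]
    by (simp add: suminf_ennreal2 ennreal_less_iff)
  \<comment> \<open>The geometric terms, of total \<open>\<kappa> / 2\<close>, make every
    \<open>e i\<close> positive even where the diameter vanishes.\<close>
  define e where "e = (\<lambda>i. diam_pow s (U i) + \<kappa> / 2 * (1 / 2) ^ Suc i)"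
  have geo: "(\<lambda>i. \<kappa> / 2 * (1 / 2) ^ Suc i) sums (\<kappa> / 2 * 1)"
    by (intro sums_mult power_half_series)
  have "e sums ((\<Sum>i. diam_pow s (U i)) + \<kappa> / 2 * 1)"
    unfolding e_def by (intro sums_add geo summable_sums summ)
  then have "summable e" "suminf e < \<kappa>" using sum_lt by (auto simp: sums_iff)
  moreover have "bounded (U i) \<and> 0 < e i \<and> diameter (U i) powr s \<le> e i" for i
    using U s \<kappa> nonneg[of i]
    by (auto simp: delta_covers_def e_def diam_pow_def intro: add_nonneg_pos)
  ultimately obtain x where "x \<in> E" "\<forall>i. x \<notin> U i" using avoid by blast
  then show False using U by (auto simp: delta_covers_def)
qed

text \<open>Exponent 0 lies outside the tree argument, but there each nonempty set of a cover
  already counts 1.\<close>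

lemma hausdorff_measure_0_pos:
  assumes "x \<in> E"
  shows "hausdorff_measure 0 E \<noteq> 0"
proof
  assume "hausdorff_measure 0 E = 0"
  then have "hausdorff_premeasure 0 1 E = 0"
    unfolding hausdorff_measure_def by (simp add: SUP_eq_iff bot_ennreal[symmetric])
  then have "(INF U \<in> delta_covers 1 E. \<Sum>i. ennreal (diam_pow 0 (U i))) < 1"
    by (simp add: hausdorff_premeasure_def)
  then obtain U where U: "U \<in> delta_covers 1 E" and lt: "(\<Sum>i. ennreal (diam_pow 0 (U i))) < 1"
    by (auto simp: INF_less_iff)
  obtain i where "x \<in> U i" using U assms by (auto simp: delta_covers_def)
  then have "1 = (\<Sum>j\<in>{i}. ennreal (diam_pow 0 (U j)))" by (auto simp: diam_pow_def)
  also have "\<dots> \<le> (\<Sum>j. ennreal (diam_pow 0 (U j)))" by (intro sum_le_suminf) auto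
  finally show False using lt by simp
qed

section \<open>Density and the exact dimension\<close>

theorem theorem1p1:
  fixes q r :: "nat \<Rightarrow> real"
  assumes "strict_mono_on {1..} q"
    and "\<And>n. n \<ge> 1 \<Longrightarrow> q n > 0"
    and "filterlim (\<lambda>n. q (n + 1) - q n) at_top sequentially"
  shows "{1<..} \<subseteq> closure (E_set q r) \<and> hausdorff_dim (E_set q r) = 1"
proof
  have meets: "\<exists>x\<in>E_set q r. b \<le> x \<and> x \<le> c" if bc: "1 < b" "b < c" for b c
  proof -
    obtain \<kappa> where \<kappa>: "0 < \<kappa>" and avoid: "\<And>U e. (\<forall>i::nat. bounded (U i) \<and> 0 < e i \<and>
        diameter (U i) powr (1/2) \<le> e i) \<Longrightarrow> summable e \<Longrightarrow> suminf e < \<kappa> \<Longrightarrow>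
        \<exists>x\<in>E_set q r \<inter> {b..c}. \<forall>i. x \<notin> U i"
      using E_set_avoids_cover[OF assms(3) _ _ bc, of "1/2" r] by auto
    have "(\<lambda>i. \<kappa> / 2 * (1 / 2) ^ Suc i) sums (\<kappa> / 2 * 1)"
      by (intro sums_mult power_half_series)
    \<comment> \<open>The cover by empty sets is admissible with any positive summable
      \<open>e\<close> of small sum, so the avoided cover only serves to produce a point; the
      exponent 1/2 is an arbitrary choice in (0, 1).\<close>
    then have "\<exists>x\<in>E_set q r \<inter> {b..c}. \<forall>i::nat. x \<notin> {}"
      using \<kappa> by (intro avoid[of "\<lambda>_. {}" "\<lambda>i. \<kappa> / 2 * (1 / 2) ^ Suc i"]) (auto simp: sums_iff)
    then show ?thesis by auto
  qed
  show "{1<..} \<subseteq> closure (E_set q r)"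
  proof
    fix y :: real assume y: "y \<in> {1<..}"
    show "y \<in> closure (E_set q r)"
      unfolding closure_approachable
    proof (intro allI impI)
      fix \<epsilon> :: real assume "0 < \<epsilon>"
      then obtain x where "x \<in> E_set q r" "y \<le> x" "x \<le> y + \<epsilon> / 2"
        using meets[of y "y + \<epsilon> / 2"] y by auto
      then show "\<exists>x\<in>E_set q r. dist x y < \<epsilon>"
        using \<open>0 < \<epsilon>\<close> by (intro bexI[of _ x]) (auto simp: dist_real_def)
    qed
  qed
  have ge: "1 \<le> s" if s: "0 \<le> s" "hausdorff_measure s (E_set q r) = 0" for s
  proof (rule ccontr)
    assume "\<not> 1 \<le> s"
    show False
    proof (cases "s = 0")
      case True
      obtain x where "x \<in> E_set q r" using meets[of 2 3] by auto
      then show False using True s hausdorff_measure_0_pos by blast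
    next
      case False
      then have s': "0 < s" "s < 1" using s \<open>\<not> 1 \<le> s\<close> by auto
      obtain \<kappa> where \<kappa>: "0 < \<kappa>" and avoid: "\<And>U e. (\<forall>i::nat. bounded (U i) \<and> 0 < e i \<and>
          diameter (U i) powr s \<le> e i) \<Longrightarrow> summable e \<Longrightarrow> suminf e < \<kappa> \<Longrightarrow>
          \<exists>x\<in>E_set q r \<inter> {2..3}. \<forall>i. x \<notin> U i"
        using E_set_avoids_cover[OF assms(3) s', of 2 3 r] by auto
      have "hausdorff_measure s (E_set q r) \<noteq> 0"
      proof (rule hausdorff_measure_pos[OF s'(1) \<kappa>])
        fix U :: "nat \<Rightarrow> real set" and e
        assume "\<And>i. bounded (U i) \<and> 0 < e i \<and> diameter (U i) powr s \<le> e i"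
          and "summable e" "suminf e < \<kappa>"
        then have "\<exists>x\<in>E_set q r \<inter> {2..3}. \<forall>i. x \<notin> U i" by (intro avoid) simp_all
        then show "\<exists>x\<in>E_set q r. \<forall>i. x \<notin> U i" by blast
      qed
      then show False using s by simp
    qed
  qed
  show "hausdorff_dim (E_set q r) = 1"
  proof (rule antisym)
    show "1 \<le> hausdorff_dim (E_set q r)"
      unfolding hausdorff_dim_def
    proof (rule Inf_greatest)
      fix z assume "z \<in> {ennreal s |s. 0 \<le> s \<and> hausdorff_measure s (E_set q r) = 0}"
      then obtain s where "z = ennreal s" "1 \<le> s" using ge by auto
      then show "1 \<le> z" by (simp add: ennreal_leI flip: ennreal_1)
    qed
    \<comment> \<open>The measure is known to vanish only for exponents above 1, so the value 1 is
      reached as a limit.\<close>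
    have "hausdorff_dim (E_set q r) \<le> ennreal (1 + \<epsilon>)" if "0 < \<epsilon>" for \<epsilon>
      unfolding hausdorff_dim_def
    proof (rule Inf_lower, intro CollectI exI conjI)
      show "hausdorff_measure (1 + \<epsilon>) (E_set q r) = 0"
        using that by (intro hausdorff_measure_real_eq_0 E_set_subset_nonneg) simp
    qed (use that in auto)
    then have "hausdorff_dim (E_set q r) \<le> 1 + ennreal \<epsilon>" if "0 < \<epsilon>" for \<epsilon>
      using that ennreal_plus[of 1 \<epsilon>] by (metis ennreal_1 less_imp_le zero_le_one)
    then show "hausdorff_dim (E_set q r) \<le> 1" by (rule ennreal_le_epsilon)
  qed
qed

end
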